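(* Let $G$ be a finite group, $F$ a field, $A = FG$ the group algebra, and $H$ an $F$-subspace of $A$ of codimension one. If $H$ is not a two-sided ideal of $A$, then $H \cap U(A) \neq \emptyset$ and $H \setminus U(A) \neq \emptyset$.
   Context: $U(A)$ denotes the group of units of $A$, i.e. the set of elements having a two-sided multiplicative inverse. *)

theory Defs
  imports Complex_Main "HOL-Library.Poly_Mapping"
begin

text \<open>
  For a type \<open>'g\<close> of class \<^class>\<open>group_add\<close> and a field \<open>'f\<close>, the type \<open>'g \<Rightarrow>\<^sub>0 'f\<close> with the ring
  structure of \<^theory>\<open>HOL-Library.Poly_Mapping\<close> (pointwise addition, convolution product) is the
  group algebra of \<open>'g\<close> over \<open>'f\<close>. The class \<^class>\<open>group_add\<close> does not assume
  commutativity: the group law, although written \<open>+\<close>, is that of an arbitrary group. The group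
  element \<open>g\<close> is the basis vector \<open>Poly_Mapping.single g 1\<close>, and products of basis vectors are
  given by the lemma \<open>single_mult_single_group\<close> below.
\<close>

lemma single_mult_single_group:
  "Poly_Mapping.single g (1::'f::field) * Poly_Mapping.single h 1
     = Poly_Mapping.single ((g::'g::group_add) + h) 1"
  by (simp add: mult_single)

definition ga_scale :: "'f::field \<Rightarrow> ('g \<Rightarrow>\<^sub>0 'f) \<Rightarrow> ('g \<Rightarrow>\<^sub>0 'f)" where
  "ga_scale c x = Poly_Mapping.map ((*) c) x"

lemma lookup_ga_scale [simp]:
  "Poly_Mapping.lookup (ga_scale c x) g = c * Poly_Mapping.lookup x g"
  unfolding ga_scale_def by transfer (simp add: when_def)

global_interpretation group_algebra:
  vector_space "ga_scale :: 'f::field \<Rightarrow> ('g \<Rightarrow>\<^sub>0 'f) \<Rightarrow> ('g \<Rightarrow>\<^sub>0 'f)"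
  by unfold_locales
    (simp_all add: poly_mapping_eq_iff fun_eq_iff lookup_add algebra_simps)

lemma dim_group_algebra:
  "group_algebra.dim (UNIV :: ('g::finite \<Rightarrow>\<^sub>0 'f::field) set) = card (UNIV :: 'g set)"
proof -
  let ?b = "\<lambda>g::'g. Poly_Mapping.single g (1::'f)"
  have inj: "inj ?b"
    by (auto simp: inj_on_def poly_mapping_eq_iff fun_eq_iff lookup_single when_def)
  have expand: "Poly_Mapping.lookup (\<Sum>g\<in>UNIV. ga_scale (u g) (?b g)) h = u h" for u h
  proof -
    have "Poly_Mapping.lookup (\<Sum>g\<in>UNIV. ga_scale (u g) (?b g)) h = (\<Sum>g\<in>UNIV. if g = h then u g else 0)"
      unfolding lookup_sum by (rule sum.cong) (auto simp: lookup_single when_def)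
    then show ?thesis by simp
  qed
  have "group_algebra.independent (range ?b)"
  proof (rule group_algebra.independent_if_scalars_zero)
    fix u x
    assume "(\<Sum>v\<in>range ?b. ga_scale (u v) v) = 0" and x: "x \<in> range ?b"
    then have "(\<Sum>g\<in>UNIV. ga_scale (u (?b g)) (?b g)) = 0"
      by (simp only: sum.reindex[OF inj] o_def)
    then have "u (?b h) = 0" for h
      using expand[of "\<lambda>g. u (?b g)" h] by simp
    with x show "u x = 0" by blast
  qed simp
  moreover have "x \<in> group_algebra.span (range ?b)" for x :: "'g \<Rightarrow>\<^sub>0 'f"
  proof -
    have "x = (\<Sum>g\<in>UNIV. ga_scale (Poly_Mapping.lookup x g) (?b g))"
      by (rule poly_mapping_eqI) (simp only: expand)
    also have "\<dots> \<in> group_algebra.span (range ?b)"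
      by (intro group_algebra.span_sum group_algebra.span_scale group_algebra.span_base) auto
    finally show ?thesis .
  qed
  ultimately have "group_algebra.dim (UNIV :: ('g \<Rightarrow>\<^sub>0 'f) set) = card (range ?b)"
    by (intro group_algebra.dim_unique) auto
  then show ?thesis using inj by (simp add: card_image)
qed

definition two_sided_units :: "'a::ring_1 set" where
  "two_sided_units = {x. \<exists>y. x * y = 1 \<and> y * x = 1}"

definition two_sided_ideal :: "'a::ring_1 set \<Rightarrow> bool" where
  "two_sided_ideal I \<longleftrightarrow>
     0 \<in> I \<and> (\<forall>x\<in>I. \<forall>y\<in>I. x + y \<in> I) \<and> (\<forall>x\<in>I. - x \<in> I) \<and>
     (\<forall>a. \<forall>x\<in>I. a * x \<in> I \<and> x * a \<in> I)"

text \<open>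
  For a finite group the algebra is finite-dimensional, so codimension one (a quotient of
  dimension one) is expressed by the dimension of the subspace; the sum avoids truncated
  subtraction.
\<close>

definition codim_one :: "('g::finite \<Rightarrow>\<^sub>0 'f::field) set \<Rightarrow> bool" where
  "codim_one H \<longleftrightarrow> group_algebra.dim H + 1 = group_algebra.dim (UNIV :: ('g \<Rightarrow>\<^sub>0 'f) set)"

end

theory Submission
  imports Defs
begin

text \<open>
  Suppose that \<open>H\<close> contains no unit. For a nilpotent \<open>a\<close> and units \<open>u\<close>, \<open>v\<close>, all \<open>u (1 + s a) v\<close> are
  units; since \<open>H\<close> has codimension one, this forces \<open>u a v \<in> H\<close>. As the units span the algebra, every
  nilpotent element lies in the largest ideal \<open>I\<close> contained in \<open>H\<close>. Hence idempotents are central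
  modulo \<open>I\<close>, and units modulo \<open>I\<close> lift to units. Now let \<open>x \<in> H\<close>. Fitting's decomposition gives an
  idempotent \<open>e\<close> such that \<open>x e\<close> is invertible in the corner of \<open>e\<close> and \<open>x (1 - e)\<close> is nilpotent.
  The unit \<open>x e + (1 - e)\<close> is not in \<open>H\<close>, so \<open>1 - e \<notin> H\<close>. For a unit \<open>u\<close>, all \<open>(1 - e) + s u e\<close> with
  \<open>s \<noteq> 0\<close> are units modulo \<open>I\<close>, so \<open>u e \<in> H\<close>. By linearity \<open>a e \<in> H\<close> for all \<open>a\<close>, and modulo \<open>I\<close> both
  \<open>a x\<close> and \<open>x a\<close> are of this form.
\<close>

section \<open>Units, nilpotents and Fitting idempotents in an arbitrary ring\<close>

lemma two_sided_unitsI: "x * y = 1 \<Longrightarrow> y * x = 1 \<Longrightarrow> x \<in> two_sided_units"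
  by (auto simp: two_sided_units_def)

lemma two_sided_units_mult:
  assumes "x \<in> two_sided_units" "y \<in> two_sided_units"
  shows "x * y \<in> two_sided_units"
proof -
  obtain x' y' where "x * x' = 1" "x' * x = 1" "y * y' = 1" "y' * y = 1"
    using assms by (auto simp: two_sided_units_def)
  then show ?thesis
    by (intro two_sided_unitsI[where y = "y' * x'"]) (metis mult.assoc mult_1_left)+
qed

lemma one_minus_nilpotent_unit:
  fixes a :: "'a::ring_1"
  assumes "a ^ n = 0"
  shows "1 - a \<in> two_sided_units"
proof (rule two_sided_unitsI)
  have comm: "a * (\<Sum>i<n. a ^ i) = (\<Sum>i<n. a ^ i) * a"
    by (simp add: sum_distrib_left sum_distrib_right power_commutes)
  have "(1 - a) * (\<Sum>i<n. a ^ i) = 1 - a ^ n" for n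
  proof (induction n)
    case (Suc n)
    then show ?case by (simp add: distrib_left) (simp add: algebra_simps)
  qed simp
  then show "(1 - a) * (\<Sum>i<n. a ^ i) = 1" using assms by simp
  with comm show "(\<Sum>i<n. a ^ i) * (1 - a) = 1" by (simp add: algebra_simps)
qed

text \<open>\<open>e\<close> is the Fitting idempotent of \<open>x\<close>, and \<open>z\<close> the inverse of \<open>x e\<close> in its corner.\<close>

definition fitting :: "'a::ring_1 \<Rightarrow> 'a \<Rightarrow> 'a \<Rightarrow> bool" where
  "fitting x e z \<longleftrightarrow> e * e = e \<and> x * z = e \<and> z * x = e \<and> z * e = z \<and> e * z = z \<and>
     (\<exists>n. (x * (1 - e)) ^ n = 0)"

text \<open>Iterating \<open>eq\<close> gives \<open>x ^ n = x ^ (n + k) * r ^ k\<close>, so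
  \<open>r ^ m\<close> inverts \<open>x ^ m\<close> up to the idempotent
  \<open>x ^ m * r ^ m\<close> once \<open>m\<close> is at least \<open>n\<close>.\<close>

lemma fittingI:
  fixes x r :: "'a::ring_1"
  assumes xr: "x * r = r * x" and eq: "x ^ n = x ^ Suc n * r"
  shows "\<exists>e z. fitting x e z"
proof -
  have comm: "x ^ i * r ^ j = r ^ j * x ^ i" for i j
    using xr by (metis power_commuting_commutes)
  have comm1: "x * r ^ j = r ^ j * x" for j
    using comm[of 1 j] by simp
  have absorb: "x ^ n = x ^ (n + k) * r ^ k" for k
  proof (induction k)
    case (Suc k)
    have "x ^ n = x ^ k * x ^ n * r ^ k" using Suc by (metis add.commute power_add)
    also have "\<dots> = x ^ k * (x ^ Suc n * r) * r ^ k" using eq by simp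
    also have "\<dots> = x ^ (n + Suc k) * r ^ Suc k"
      by (simp add: mult.assoc flip: power_add power_Suc)
        (simp add: add.commute flip: mult.assoc power_Suc power_add)
    finally show ?case .
  qed simp
  \<comment> \<open>A positive exponent is needed: \<open>z\<close> arises from \<open>e\<close> by
    removing one factor \<open>x\<close>, and \<open>pow\<close> fails at exponent 0 unless
    \<open>e = 0\<close>.\<close>
  define m where "m = Suc n"
  define e where "e = x ^ m * r ^ m"
  have xm: "x ^ m = x ^ (m + m) * r ^ m"
    using absorb[of m] unfolding m_def by (metis (no_types) add_Suc mult.assoc power_Suc)
  have ee: "e * e = e"
  proof -
    have "e * e = x ^ m * (r ^ m * x ^ m) * r ^ m" by (simp add: e_def mult.assoc)
    also have "\<dots> = x ^ (m + m) * r ^ m * r ^ m"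
      unfolding comm[symmetric] by (simp add: mult.assoc power_add)
    finally show ?thesis using xm e_def by simp
  qed
  have xe: "x * e = e * x"
    unfolding e_def by (metis comm1 mult.assoc power_commutes)
  define z where "z = x ^ n * r ^ m * e"
  have xz: "x * z = e"
    using ee by (simp add: z_def e_def m_def mult.assoc)
  have zx: "z * x = x * z"
    unfolding z_def by (metis comm1 mult.assoc power_commutes xe)
  have ze: "z * e = z" by (simp add: z_def mult.assoc ee)
  have ez: "e * z = z" by (metis mult.assoc xz zx ze)
  have pow: "(x * (1 - e)) ^ k = x ^ k * (1 - e)" if "k > 0" for k
    using that
  proof (induction k rule: nat_induct_non_zero)
    case (Suc k)
    have "(1 - e) * (x ^ k * (1 - e)) = x ^ k * ((1 - e) * (1 - e))"
      using power_commuting_commutes[of "1 - e" x k] xe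
      by (simp add: algebra_simps) (metis power_commuting_commutes mult.assoc)
    moreover have "(1 - e) * (1 - e) = 1 - e" by (simp add: algebra_simps ee)
    ultimately show ?case using Suc by (simp add: mult.assoc)
  qed simp
  have "x ^ m * e = x ^ m"
    using xm by (simp add: e_def power_add mult.assoc)
  then have "x ^ m * (1 - e) = 0" by (simp add: right_diff_distrib)
  then have "(x * (1 - e)) ^ m = 0" using pow[of m] by (simp add: m_def)
  then show ?thesis using ee xz zx ze ez unfolding fitting_def by metis
qed

text \<open>The inverse is \<open>z\<close> on the corner of \<open>e\<close> and the identity on
  that of \<open>1 - e\<close>.\<close>

lemma fitting_unit:
  assumes "fitting x e z"
  shows "x * e + (1 - e) \<in> two_sided_units"
proof (rule two_sided_unitsI)
  have f: "e * e = e" "x * z = e" "z * x = e" "z * e = z" "e * z = z"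
    using assms by (auto simp: fitting_def)
  have "x * e = e * x" by (metis f(2,3) mult.assoc)
  then show "(x * e + (1 - e)) * (z + (1 - e)) = 1" "(z + (1 - e)) * (x * e + (1 - e)) = 1"
    using f by (simp_all add: algebra_simps) (simp_all add: f flip: mult.assoc)
qed

section \<open>Finite-dimensional algebras: existence of Fitting idempotents, and lines meeting a
  hyperplane\<close>

locale finite_dimensional_algebra = vector_space scale
  for scale :: "'f::field \<Rightarrow> 'a::ring_1 \<Rightarrow> 'a" (infixr \<open>*s\<close> 75) +
  assumes scale_mult_left: "(c *s x) * y = c *s (x * y)"
    and scale_mult_right: "x * (c *s y) = c *s (x * y)"
    and finite_spanning: "\<exists>B. finite B \<and> span B = UNIV"
begin

lemma scale_unit:
  assumes "c \<noteq> 0" "u \<in> two_sided_units"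
  shows "c *s u \<in> two_sided_units"
proof -
  obtain v where "u * v = 1" "v * u = 1" using assms(2) by (auto simp: two_sided_units_def)
  then show ?thesis using assms(1)
    by (intro two_sided_unitsI[where y = "inverse c *s v"]) (simp_all add: scale_mult_left scale_mult_right)
qed

lemma power_in_span_higher_powers:
  fixes x :: 'a
  shows "\<exists>n. x ^ n \<in> span ((\<lambda>m. x ^ m) ` {n<..})"
proof (rule ccontr)
  assume contra: "\<nexists>n. x ^ n \<in> span ((\<lambda>m. x ^ m) ` {n<..})"
  \<comment> \<open>The cardinality records that the powers are distinct, which independence of the
    image set does not. The start \<open>n\<close> varies because the induction adds the lowest
    power.\<close>
  have indep: "independent ((\<lambda>m. x ^ m) ` {n..<n+k}) \<and> card ((\<lambda>m. x ^ m) ` {n..<n+k}) = k" for n k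
  proof (induction k arbitrary: n)
    case (Suc k)
    let ?S = "(\<lambda>m. x ^ m) ` {Suc n..<Suc n + k}"
    have "?S \<subseteq> (\<lambda>m. x ^ m) ` {n<..}" by auto
    then have "x ^ n \<notin> span ?S" using contra span_mono by blast
    moreover from this have "x ^ n \<notin> ?S" using span_base by blast
    moreover have "(\<lambda>m. x ^ m) ` {n..<n + Suc k} = insert (x ^ n) ?S"
      unfolding image_insert[symmetric] by (rule arg_cong[where f = "image _"]) auto
    ultimately show ?case using Suc[of "Suc n"] by (simp add: independent_insertI)
  qed (simp add: independent_empty)
  obtain B where "finite B" "span B = UNIV" using finite_spanning by blast
  with indep[of 0 "Suc (card B)"] show False
    using independent_span_bound[of B "(\<lambda>m. x ^ m) ` {0..<0 + Suc (card B)}"] by auto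
qed

lemma ex_fitting:
  fixes x :: 'a
  shows "\<exists>e z. fitting x e z"
proof -
  obtain n where n: "x ^ n \<in> span ((\<lambda>m. x ^ m) ` {n<..})"
    using power_in_span_higher_powers by blast
  \<comment> \<open>Commuting with \<open>x\<close> is a linear condition on \<open>r\<close>, so
    \<open>?P\<close> passes from the higher powers to their span.\<close>
  let ?P = "\<lambda>y. \<exists>r. x * r = r * x \<and> y = x ^ Suc n * r"
  have "?P (x ^ n)" using n
  proof (rule span_induct)
    show "subspace {y. ?P y}"
    proof (rule subspaceI)
      show "0 \<in> {y. ?P y}" by (auto intro: exI[of _ 0])
    next
      fix y z assume "y \<in> {y. ?P y}" "z \<in> {y. ?P y}"
      then obtain r s where "x * r = r * x" "y = x ^ Suc n * r" "x * s = s * x" "z = x ^ Suc n * s"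
        by blast
      then show "y + z \<in> {y. ?P y}"
        by (intro CollectI exI[of _ "r + s"]) (simp add: distrib_left distrib_right)
    next
      fix c y assume "y \<in> {y. ?P y}"
      then obtain r where "x * r = r * x" "y = x ^ Suc n * r" by blast
      then show "c *s y \<in> {y. ?P y}"
        by (intro CollectI exI[of _ "c *s r"]) (simp add: scale_mult_left scale_mult_right)
    qed
  next
    fix y assume "y \<in> (\<lambda>m. x ^ m) ` {n<..}"
    then obtain m where "y = x ^ m" "n < m" by auto
    then show "?P y"
      by (intro exI[of _ "x ^ (m - Suc n)"])
        (simp add: power_commutes flip: power_add power_Suc)
  qed
  then show ?thesis using fittingI by blast
qed

text \<open>\<open>H\<close> and \<open>w\<close> together span the algebra, so
  \<open>v - k *s w\<close> lies in \<open>H\<close> for some \<open>k\<close>, and \<open>k\<close>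
  is nonzero because \<open>v\<close> is outside \<open>H\<close>.\<close>

lemma codim_one_complement:
  assumes H: "subspace H" and dim: "dim H + 1 = dim (UNIV :: 'a set)"
    and v: "v \<notin> H" and w: "w \<notin> H"
  shows "\<exists>s. s \<noteq> 0 \<and> v + s *s w \<in> H"
proof -
  obtain T where T: "finite T" "span T = UNIV" using finite_spanning by blast
  obtain C where C: "independent C" "UNIV \<subseteq> span C" "card C = dim (UNIV :: 'a set)"
    using basis_exists[of UNIV] by auto
  have finC: "finite C" using independent_span_bound[OF T(1) C(1)] T by simp
  obtain B where B: "B \<subseteq> H" "independent B" "H \<subseteq> span B" "card B = dim H"
    using basis_exists[of H] by auto
  have finB: "finite B" using independent_span_bound[OF T(1) B(2)] T by simp
  have spB: "span B = H" using B(1,3) H span_minimal by blast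
  have wB: "independent (insert w B)" using B(2) w spB by (simp add: independent_insertI)
  have card_wB: "card (insert w B) = card C"
    using w B(1) finB B(4) C(3) dim by (subst card_insert_disjoint) auto
  have "v \<in> span (insert w B)"
  proof (rule ccontr)
    assume v': "v \<notin> span (insert w B)"
    then have "independent (insert v (insert w B))" using wB by (simp add: independent_insertI)
    then have "card (insert v (insert w B)) \<le> card C"
      using independent_span_bound[OF finC] C(2) by blast
    moreover have "v \<notin> insert w B" using v' span_base by blast
    ultimately show False using card_wB finB by (simp add: card_insert_disjoint)
  qed
  then obtain k where k: "v - k *s w \<in> H" using spB by (auto simp: span_insert)
  then have "k \<noteq> 0" using v by auto
  with k show ?thesis by (intro exI[of _ "- k"]) simp
qed

end

section \<open>Hyperplanes without units in an algebra spanned by its units\<close>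

locale unit_avoiding_hyperplane = finite_dimensional_algebra scale
  for scale :: "'f::field \<Rightarrow> 'a::ring_1 \<Rightarrow> 'a" (infixr \<open>*s\<close> 75) +
  fixes H :: "'a set"
  assumes span_units: "span two_sided_units = (UNIV :: 'a set)"
    and subspace_H: "subspace H"
    and dim_H: "dim H + 1 = dim (UNIV :: 'a set)"
    and unit_notin: "u \<in> two_sided_units \<Longrightarrow> u \<notin> H"
begin

text \<open>The ideal \<open>I\<close> of the overview, the largest two-sided ideal inside
  \<open>H\<close>.\<close>

definition core :: "'a set" where
  "core = {a. \<forall>x y. x * a * y \<in> H}"

text \<open>The preimage of \<open>H\<close> under a linear map is a subspace, and the units span.
  This turns a unit factor into an arbitrary one.\<close>

lemma units_linear_induct:
  assumes lin: "\<And>x y. f (x + y) = f x + f y" "\<And>c x. f (c *s x) = c *s f x"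
    and units: "\<And>u. u \<in> two_sided_units \<Longrightarrow> f u \<in> H"
  shows "f x \<in> H"
proof -
  have "f 0 = 0" using lin(2)[of 0 0] by simp
  then have "subspace {x. f x \<in> H}"
    using subspace_H by (intro subspaceI) (auto simp: lin subspace_0 subspace_add subspace_scale)
  then show ?thesis
    using span_induct[of x two_sided_units "\<lambda>x. f x \<in> H"] span_units units by auto
qed

lemma core_subset: "a \<in> core \<Longrightarrow> a \<in> H"
  unfolding core_def by (metis (mono_tags) mem_Collect_eq mult_1_left mult_1_right)

lemma core_mult_left: "a \<in> core \<Longrightarrow> b * a \<in> core"
  by (simp add: core_def flip: mult.assoc)

lemma core_mult_right: "a \<in> core \<Longrightarrow> a * b \<in> core"
  by (simp add: core_def mult.assoc)

lemma core_diff: "a \<in> core \<Longrightarrow> b \<in> core \<Longrightarrow> a - b \<in> core"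
  using subspace_H by (simp add: core_def algebra_simps subspace_diff)

lemma nilpotent_in_core:
  assumes "a ^ n = 0"
  shows "a \<in> core"
proof -
  have uv: "u * a * v \<in> H" if u: "u \<in> two_sided_units" and v: "v \<in> two_sided_units" for u v
  proof (rule ccontr)
    assume "u * a * v \<notin> H"
    moreover have "u * v \<notin> H" using u v unit_notin two_sided_units_mult by blast
    ultimately obtain s where "u * v + s *s (u * a * v) \<in> H"
      using codim_one_complement[OF subspace_H dim_H] by blast
    \<comment> \<open>The factorisation exhibits an element of \<open>H\<close> as a product of
      units, since \<open>s *s a\<close> is nilpotent.\<close>
    moreover have "u * v + s *s (u * a * v) = u * (1 - (- s) *s a) * v"
      by (simp add: algebra_simps scale_mult_left scale_mult_right)
    moreover have pow: "(c *s a) ^ k = c ^ k *s a ^ k" for c k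
      by (induction k) (simp_all add: scale_mult_left scale_mult_right)
    moreover have "((- s) *s a) ^ n = 0" using assms by (simp add: pow del: scale_minus_left)
    then have "1 - (- s) *s a \<in> two_sided_units" by (rule one_minus_nilpotent_unit)
    ultimately show False using u v unit_notin two_sided_units_mult by metis
  qed
  have uy: "u * a * y \<in> H" if "u \<in> two_sided_units" for u y
    by (rule units_linear_induct) (use that uv in \<open>simp_all add: algebra_simps scale_mult_right\<close>)
  have "x * a * y \<in> H" for x y
    by (rule units_linear_induct[of "\<lambda>x. x * a * y"])
      (simp_all add: uy distrib_right scale_mult_left)
  then show ?thesis by (simp add: core_def)
qed

text \<open>Both elements have square zero, and their difference is \<open>e * a - a * e\<close>;
  hence \<open>e\<close> is central modulo \<open>core\<close>.\<close>

lemma idempotent_corner_in_core: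
  assumes "e * e = e"
  shows "e * a * (1 - e) \<in> core" "(1 - e) * a * e \<in> core"
proof -
  have [simp]: "e * (e * x) = e * x" for x using assms by (simp flip: mult.assoc)
  have "(e * a * (1 - e)) ^ 2 = 0" "((1 - e) * a * e) ^ 2 = 0"
    by (simp_all add: power2_eq_square algebra_simps assms)
  then show "e * a * (1 - e) \<in> core" "(1 - e) * a * e \<in> core"
    by (blast intro: nilpotent_in_core)+
qed

text \<open>If \<open>y\<close> were in \<open>H\<close>, its nilpotent part
  \<open>y * (1 - e)\<close> would lie in \<open>core\<close>, and multiplying by \<open>y'\<close>
  would put \<open>1 - e\<close> there too. Then \<open>y\<close> would agree modulo
  \<open>core\<close> with the unit \<open>y * e + (1 - e)\<close>.\<close>

lemma invertible_mod_core_notin: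
  assumes "y' * y - 1 \<in> core"
  shows "y \<notin> H"
proof
  assume y: "y \<in> H"
  obtain e z where f: "fitting y e z" using ex_fitting by blast
  then obtain n where "(y * (1 - e)) ^ n = 0" by (auto simp: fitting_def)
  then have nil: "y * (1 - e) \<in> core" by (rule nilpotent_in_core)
  have "y' * (y * (1 - e)) - (y' * y - 1) * (1 - e) \<in> core"
    by (rule core_diff[OF core_mult_left[OF nil] core_mult_right[OF assms]])
  then have "1 - e \<in> core" by (simp add: algebra_simps)
  then have "y - (y * (1 - e) - (1 - e)) \<in> H"
    by (rule subspace_diff[OF subspace_H y core_subset[OF core_diff[OF nil]]])
  moreover have "y - (y * (1 - e) - (1 - e)) = y * e + (1 - e)" by (simp add: algebra_simps)
  ultimately show False using fitting_unit[OF f] unit_notin by simp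
qed

lemma absorbs:
  assumes x: "x \<in> H"
  shows "a * x \<in> H" "x * a \<in> H"
proof -
  obtain e z where f: "fitting x e z" using ex_fitting by blast
  then have ee: "e * e = e" by (simp add: fitting_def)
  obtain n where "(x * (1 - e)) ^ n = 0" using f by (auto simp: fitting_def)
  then have nil: "x * (1 - e) \<in> core" by (rule nilpotent_in_core)
  have e1: "1 - e \<notin> H"
  proof
    assume "1 - e \<in> H"
    then have "x - x * (1 - e) + (1 - e) \<in> H"
      by (rule subspace_add[OF subspace_H subspace_diff[OF subspace_H x core_subset[OF nil]]])
    then show False using fitting_unit[OF f] unit_notin by (simp add: algebra_simps)
  qed
  have unit_e: "u * e \<in> H" if u: "u \<in> two_sided_units" for u
  proof (rule ccontr)
    assume "u * e \<notin> H"
    then obtain s where s: "s \<noteq> 0" "1 - e + s *s (u * e) \<in> H"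
      using codim_one_complement[OF subspace_H dim_H e1] by blast
    obtain w' where w': "w' * (s *s u) = 1"
      using scale_unit[OF s(1) u] by (auto simp: two_sided_units_def)
    let ?w = "s *s u"
    have [simp]: "e * (e * b) = e * b" "w' * (?w * b) = b" for b
      using ee w' by (simp_all flip: mult.assoc)
    \<comment> \<open>Modulo \<open>core\<close>, \<open>1 - e + w' * e\<close> is a left inverse of
      \<open>1 - e + ?w * e\<close>: the error consists of corner elements.\<close>
    have "(1 - e) * ?w * e - w' * ((1 - e) * ?w * e) \<in> core"
      by (intro core_diff core_mult_left[of _ w'] idempotent_corner_in_core[OF ee])
    also have "(1 - e) * ?w * e - w' * ((1 - e) * ?w * e)
        = (1 - e + w' * e) * (1 - e + ?w * e) - 1"
      by (simp add: algebra_simps ee)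
    finally have "1 - e + ?w * e \<notin> H" by (rule invertible_mod_core_notin)
    then show False using s(2) by (simp add: scale_mult_left)
  qed
  have be: "b * e \<in> H" for b
    by (rule units_linear_induct) (use unit_e in \<open>simp_all add: algebra_simps scale_mult_left\<close>)
  have "a * x * e + a * (x * (1 - e)) \<in> H"
    by (rule subspace_add[OF subspace_H be core_subset[OF core_mult_left[OF nil]]])
  then show "a * x \<in> H" by (simp add: algebra_simps)
  \<comment> \<open>The second factor is the commutator \<open>e * a - a * e\<close>, which moves
    \<open>e\<close> past \<open>a\<close> in \<open>x * e * a\<close>.\<close>
  have "x * (e * a * (1 - e) - (1 - e) * a * e) \<in> core"
    by (intro core_mult_left[of _ x] core_diff idempotent_corner_in_core[OF ee])
  then have "x * a * e + (x * (e * a * (1 - e) - (1 - e) * a * e) + x * (1 - e) * a) \<in> H"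
    by (intro subspace_add[OF subspace_H] be core_subset core_mult_right[OF nil])
  then show "x * a \<in> H" by (simp add: algebra_simps)
qed

lemma two_sided_ideal_H: "two_sided_ideal H"
  using subspace_H absorbs
  by (auto simp: two_sided_ideal_def subspace_0 subspace_add subspace_neg)

end

section \<open>The group algebra as an instance\<close>

lemma sum_singles: "x = (\<Sum>g\<in>UNIV. Poly_Mapping.single g (Poly_Mapping.lookup x g))"
  for x :: "'g::finite \<Rightarrow>\<^sub>0 'b::comm_monoid_add"
  by (rule poly_mapping_eqI) (simp add: lookup_sum lookup_single when_def)

text \<open>Scalars are central elements of the algebra, which reduces the compatibility of scaling
  with products to associativity.\<close>

lemma ga_scale_eq_mult:
  fixes x :: "'g::{group_add, finite} \<Rightarrow>\<^sub>0 'f::field"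
  shows "ga_scale c x = Poly_Mapping.single 0 c * x" "ga_scale c x = x * Poly_Mapping.single 0 c"
proof -
  show left: "ga_scale c x = Poly_Mapping.single 0 c * x"
    by (simp add: ga_scale_def mult_map_scale_conv_mult)
  have "Poly_Mapping.single 0 c * x = x * Poly_Mapping.single 0 c"
    by (subst (1 2) sum_singles[of x])
      (simp add: sum_distrib_left sum_distrib_right mult_single mult.commute)
  with left show "ga_scale c x = x * Poly_Mapping.single 0 c" by simp
qed

lemma single_unit: "Poly_Mapping.single (g :: 'g::group_add) (1::'f::field) \<in> two_sided_units"
  by (rule two_sided_unitsI[where y = "Poly_Mapping.single (- g) 1"])
    (simp_all add: single_mult_single_group)

lemma span_singles:
  "group_algebra.span (range (\<lambda>g::'g::finite. Poly_Mapping.single g (1::'f::field))) = UNIV"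
proof -
  have single: "Poly_Mapping.single g c = ga_scale c (Poly_Mapping.single g 1)" for g :: 'g and c :: 'f
    by (rule poly_mapping_eqI) (simp add: lookup_single when_def)
  have "(\<Sum>g\<in>UNIV. Poly_Mapping.single g (Poly_Mapping.lookup x g))
      \<in> group_algebra.span (range (\<lambda>g. Poly_Mapping.single g 1))" for x :: "'g \<Rightarrow>\<^sub>0 'f"
    by (subst single) (intro group_algebra.span_sum group_algebra.span_scale group_algebra.span_base rangeI)
  then show ?thesis by (metis sum_singles UNIV_eq_I)
qed

theorem theorem4:
  fixes H :: "('g::{group_add, finite} \<Rightarrow>\<^sub>0 'f::field) set"
  assumes "group_algebra.subspace H"
    and "codim_one H"
    and "\<not> two_sided_ideal H"
  shows "H \<inter> two_sided_units \<noteq> {} \<and> H - two_sided_units \<noteq> {}"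
proof
  show "H \<inter> two_sided_units \<noteq> {}"
  proof
    assume disjoint: "H \<inter> two_sided_units = {}"
    let ?b = "\<lambda>g::'g. Poly_Mapping.single g (1::'f)"
    interpret unit_avoiding_hyperplane "ga_scale :: 'f \<Rightarrow> ('g \<Rightarrow>\<^sub>0 'f) \<Rightarrow> _" H
    proof unfold_locales
      fix c :: 'f and x y :: "'g \<Rightarrow>\<^sub>0 'f"
      show "ga_scale c x * y = ga_scale c (x * y)"
        by (simp add: ga_scale_eq_mult(1) mult.assoc)
      show "x * ga_scale c y = ga_scale c (x * y)"
        by (simp add: ga_scale_eq_mult(2) mult.assoc)
    next
      show "\<exists>B. finite B \<and> group_algebra.span B = (UNIV :: ('g \<Rightarrow>\<^sub>0 'f) set)"
        using span_singles by (intro exI[of _ "range ?b"]) simp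
      \<comment> \<open>The group elements are units and already span the algebra.\<close>
      show "group_algebra.span two_sided_units = (UNIV :: ('g \<Rightarrow>\<^sub>0 'f) set)"
        using group_algebra.span_mono[of "range ?b" two_sided_units] single_unit span_singles by blast
    qed (use assms disjoint in \<open>auto simp: codim_one_def\<close>)
    show False using two_sided_ideal_H assms(3) by blast
  qed
next
  have "0 \<in> H" using assms(1) by (rule group_algebra.subspace_0)
  moreover have "(0 :: 'g \<Rightarrow>\<^sub>0 'f) \<notin> two_sided_units" by (simp add: two_sided_units_def)
  ultimately show "H - two_sided_units \<noteq> {}" by blast
qed

end
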